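(* For any $n\times n$ complex matrices $A_1,A_2,A_3,A_4$, $$\sigma\left(\begin{bmatrix}0 & A_2 \\ A_1 & 0\end{bmatrix}\right)=\delta\left(\begin{bmatrix}0 & A_2 \\ A_1 & 0\end{bmatrix}\right)\prec_w\delta\left(\begin{bmatrix}A_3 & A_2 \\ A_1 & A_4\end{bmatrix}\right).$$
   Context: For $M\in\mathbb{C}^{N\times N}$, $\sigma(M)$ is the vector of singular values in decreasing order. For $x,y\in\mathbb{R}^N$, $x\prec_w y$ (weak majorization) means $\sum_{i=1}^k x_i^{\downarrow}\le\sum_{i=1}^k y_i^{\downarrow}$ for $k=1,\dots,N$, where $x^{\downarrow}$ is the nonincreasing rearrangement of $x$. For $M\in\mathbb{C}^{N\times N}$ and $1\le k\le N$ the $k$-th discrepancy seminorm is $$\|M\|^{\delta}_{(k)}=\max\Big|\sum_{i=1}^k\langle Mx_i,y_i\rangle\Big|,$$ the maximum being over all pairs of orthonormal families $\{x_j\}_{j=1}^k$, $\{y_j\}_{j=1}^k$ in $\mathbb{C}^N$ with $\sum_{j=1}^k\langle x_j,y_j\rangle=0$; also $\|M\|^{\delta}_{(0)}=0$. The $k$-th discrepancy value is $\delta_k(M)=\|M\|^{\delta}_{(k)}-\|M\|^{\delta}_{(k-1)}$, and $\delta(M)=(\delta_1(M),\dots,\delta_N(M))$ (decreasingly sorted). Here $N=2n$. *)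

theory Defs
  imports Complex_Main "HOL-Library.Multiset" "Jordan_Normal_Form.Schur_Decomposition"
begin

definition decreasing_rearrangement :: "real list \<Rightarrow> real list" where
  "decreasing_rearrangement xs = rev (sort xs)"

definition weakly_majorized :: "real list \<Rightarrow> real list \<Rightarrow> bool" (infix \<open>\<prec>\<^sub>w\<close> 50) where
  "xs \<prec>\<^sub>w ys \<longleftrightarrow> length xs = length ys \<and>
     (\<forall>k\<in>{1..length xs}. sum_list (take k (decreasing_rearrangement xs))
                           \<le> sum_list (take k (decreasing_rearrangement ys)))"

(* Square roots of the eigenvalues of M* M, with algebraic multiplicity. These eigenvalues
   are real and nonnegative, so that Re only changes the type. *)
definition singular_values :: "complex mat \<Rightarrow> real list" where
  "singular_values M = rev (sorted_list_of_multiset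
     (image_mset (\<lambda>z. sqrt (Re z)) (proots (char_poly (mat_adjoint M * M)))))"

definition orthonormal_family :: "nat \<Rightarrow> nat \<Rightarrow> (nat \<Rightarrow> complex vec) \<Rightarrow> bool" where
  "orthonormal_family N k x \<longleftrightarrow>
     (\<forall>i\<in>{1..k}. x i \<in> carrier_vec N) \<and>
     (\<forall>i\<in>{1..k}. \<forall>j\<in>{1..k}. x i \<bullet>c x j = (if i = j then 1 else 0))"

(* For an N x N matrix with N >= 2 and 1 <= k <= N the set below is nonempty and compact, so
   that its supremum is a maximum. (For N = 1 there are no admissible families.) *)
definition discrepancy_seminorm :: "nat \<Rightarrow> complex mat \<Rightarrow> real" where
  "discrepancy_seminorm k M =
     (if k = 0 then 0
      else Sup {cmod (\<Sum>i=1..k. (M *\<^sub>v x i) \<bullet>c y i) | x y.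
                  orthonormal_family (dim_row M) k x \<and>
                  orthonormal_family (dim_row M) k y \<and>
                  (\<Sum>i=1..k. x i \<bullet>c y i) = 0})"

definition discrepancy_value :: "nat \<Rightarrow> complex mat \<Rightarrow> real" where
  "discrepancy_value k M = discrepancy_seminorm k M - discrepancy_seminorm (k - 1) M"

definition discrepancy_values :: "complex mat \<Rightarrow> real list" where
  "discrepancy_values M =
     decreasing_rearrangement (map (\<lambda>k. discrepancy_value k M) [1..<dim_row M + 1])"

end

theory Submission
  imports Defs "Jordan_Normal_Form.Spectral_Radius" "HOL-Combinatorics.Permutations"
begin

text \<open>
  Let \<open>M0\<close> be the matrix with zero diagonal blocks. If \<open>v\<close>, \<open>u\<close> are corresponding singular vectors
  of \<open>A1\<close>, then \<open>(v, 0)\<close> and \<open>(0, u)\<close> are corresponding singular vectors of \<open>M0\<close>, and similarly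
  \<open>(0, v)\<close> and \<open>(u, 0)\<close> for \<open>A2\<close>. So \<open>M0\<close> has a complete system of singular vectors in which every
  right vector is orthogonal to its left partner. It is therefore admissible for the discrepancy
  seminorms and attains in them the Ky Fan bound, the sum of the \<open>k\<close> largest singular values.
  The form \<open>\<langle>M x, y\<rangle>\<close> evaluated at such a pair does not see the diagonal blocks, so the same
  families show that the seminorms of the full matrix are at least as large.
\<close>

subsection \<open>Orthonormal families\<close>

lemma cscalar_prod_sum:
  fixes x y :: "complex vec"
  assumes "y \<in> carrier_vec n"
  shows "x \<bullet>c y = (\<Sum>a<n. x $ a * cnj (y $ a))"
  using assms by (auto simp: scalar_prod_def conjugate_complex_def lessThan_atLeast0 intro!: sum.cong)

lemma mult_mat_vec_sum:
  fixes A :: "complex mat"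
  assumes "A \<in> carrier_mat m n" "x \<in> carrier_vec n" "i < m"
  shows "(A *\<^sub>v x) $ i = (\<Sum>a<n. A $$ (i, a) * x $ a)"
  using assms by (auto simp: scalar_prod_def lessThan_atLeast0 intro!: sum.cong)

lemma cscalar_prod_commute:
  fixes x y :: "complex vec"
  assumes "x \<in> carrier_vec n" "y \<in> carrier_vec n"
  shows "y \<bullet>c x = cnj (x \<bullet>c y)"
  using assms by (simp add: cscalar_prod_sum[of _ n] mult.commute)

lemma cscalar_prod_self:
  fixes x :: "complex vec"
  assumes "x \<in> carrier_vec n"
  shows "x \<bullet>c x = of_real (\<Sum>a<n. (cmod (x $ a))\<^sup>2)"
  using assms by (simp add: cscalar_prod_sum[of _ n] complex_norm_square[symmetric])

lemma cscalar_prod_minus_left: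
  fixes x y z :: "complex vec"
  assumes "x \<in> carrier_vec n" "y \<in> carrier_vec n" "z \<in> carrier_vec n"
  shows "(x - y) \<bullet>c z = x \<bullet>c z - y \<bullet>c z"
  using assms by (simp add: cscalar_prod_sum[of _ n] algebra_simps sum_subtractf)

lemma cscalar_prod_smult_left:
  fixes x y :: "complex vec"
  assumes "x \<in> carrier_vec n" "y \<in> carrier_vec n"
  shows "(c \<cdot>\<^sub>v x) \<bullet>c y = c * (x \<bullet>c y)"
  using assms by (simp add: cscalar_prod_sum[of _ n] sum_distrib_left mult.assoc)

lemma cscalar_prod_smult_right:
  fixes x y :: "complex vec"
  assumes "x \<in> carrier_vec n" "y \<in> carrier_vec n"
  shows "x \<bullet>c (c \<cdot>\<^sub>v y) = cnj c * (x \<bullet>c y)"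
  using assms by (simp add: cscalar_prod_sum[of _ n] sum_distrib_left mult_ac)

lemma mat_adjoint_carrier:
  fixes A :: "complex mat"
  assumes "A \<in> carrier_mat m n"
  shows "mat_adjoint A \<in> carrier_mat n m"
  using assms by (auto simp: mat_adjoint_def)

lemma mat_adjoint_index:
  fixes A :: "complex mat"
  assumes "A \<in> carrier_mat m n" "i < n" "j < m"
  shows "mat_adjoint A $$ (i, j) = cnj (A $$ (j, i))"
  using assms by (simp add: mat_adjoint_def mat_of_rows_def)

lemma cscalar_prod_mat_adjoint:
  fixes A :: "complex mat"
  assumes A: "A \<in> carrier_mat m n" and x: "x \<in> carrier_vec m" and y: "y \<in> carrier_vec n"
  shows "(mat_adjoint A *\<^sub>v x) \<bullet>c y = x \<bullet>c (A *\<^sub>v y)"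
proof -
  have "(mat_adjoint A *\<^sub>v x) \<bullet>c y = (\<Sum>a<n. \<Sum>b<m. cnj (A $$ (b, a)) * x $ b * cnj (y $ a))"
    using assms mat_adjoint_carrier[OF A]
    by (simp add: cscalar_prod_sum[of _ n] mult_mat_vec_sum[of _ n m] sum_distrib_right
        mat_adjoint_index[OF A] del: index_mult_mat_vec)
  also have "\<dots> = (\<Sum>b<m. \<Sum>a<n. cnj (A $$ (b, a)) * x $ b * cnj (y $ a))"
    by (rule sum.swap)
  also have "\<dots> = x \<bullet>c (A *\<^sub>v y)"
    using assms
    by (simp add: cscalar_prod_sum[of _ m] mult_mat_vec_sum[of _ m n] sum_distrib_left mult_ac
        del: index_mult_mat_vec)
  finally show ?thesis .
qed

section \<open>Orthonormal systems over an index set and linear combinations\<close>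

text \<open>The index set is arbitrary so that one notion serves full bases over
  \<open>{..<n}\<close>, the families over \<open>{1..k}\<close> in the discrepancy seminorm, and
  the partial systems that occur while a basis is being built.\<close>

definition orthonormal_on :: "nat \<Rightarrow> nat set \<Rightarrow> (nat \<Rightarrow> complex vec) \<Rightarrow> bool" where
  "orthonormal_on n J x \<longleftrightarrow>
     (\<forall>i\<in>J. x i \<in> carrier_vec n) \<and> (\<forall>i\<in>J. \<forall>j\<in>J. x i \<bullet>c x j = (if i = j then 1 else 0))"

lemma orthonormal_onD:
  assumes "orthonormal_on n J x" "i \<in> J"
  shows "x i \<in> carrier_vec n" and "j \<in> J \<Longrightarrow> x i \<bullet>c x j = (if i = j then 1 else 0)"
  using assms by (auto simp: orthonormal_on_def)

lemma orthonormal_on_reindex: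
  assumes "orthonormal_on n J x" "inj_on p I" "p ` I \<subseteq> J"
  shows "orthonormal_on n I (x \<circ> p)"
  unfolding orthonormal_on_def
proof (intro conjI ballI)
  fix i j assume ij: "i \<in> I" "j \<in> I"
  then have "p i \<in> J" "p j \<in> J" using assms(3) by auto
  then show "(x \<circ> p) i \<bullet>c (x \<circ> p) j = (if i = j then 1 else 0)"
    using orthonormal_onD(2)[OF assms(1), of "p i" "p j"] inj_on_eq_iff[OF assms(2) ij] by simp
qed (use assms in \<open>auto simp: orthonormal_on_def\<close>)

text \<open>The sum of the vectors \<open>c j \<cdot>\<^sub>v u j\<close>, written by coordinates:
  inner products and matrix products with it then reduce to exchanging two sums.\<close>

definition combination :: "nat \<Rightarrow> nat set \<Rightarrow> (nat \<Rightarrow> complex) \<Rightarrow> (nat \<Rightarrow> complex vec) \<Rightarrow> complex vec" where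
  "combination n J c u = vec n (\<lambda>a. \<Sum>j\<in>J. c j * u j $ a)"

lemma combination_carrier [simp]: "combination n J c u \<in> carrier_vec n"
  by (simp add: combination_def)

lemma combination_cscalar_left:
  assumes "y \<in> carrier_vec n" "\<And>j. j \<in> J \<Longrightarrow> u j \<in> carrier_vec n"
  shows "combination n J c u \<bullet>c y = (\<Sum>j\<in>J. c j * (u j \<bullet>c y))"
proof -
  have "combination n J c u \<bullet>c y = (\<Sum>a<n. \<Sum>j\<in>J. c j * u j $ a * cnj (y $ a))"
    using assms by (simp add: cscalar_prod_sum[of _ n] combination_def sum_distrib_right)
  also have "\<dots> = (\<Sum>j\<in>J. \<Sum>a<n. c j * u j $ a * cnj (y $ a))"
    by (rule sum.swap)
  also have "\<dots> = (\<Sum>j\<in>J. c j * (u j \<bullet>c y))"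
    using assms by (simp add: cscalar_prod_sum[of _ n] sum_distrib_left mult.assoc)
  finally show ?thesis .
qed

lemma mult_mat_combination:
  assumes A: "A \<in> carrier_mat m n" and u: "\<And>j. j \<in> J \<Longrightarrow> u j \<in> carrier_vec n"
  shows "A *\<^sub>v combination n J c u = combination m J c (\<lambda>j. A *\<^sub>v u j)"
proof (rule eq_vecI)
  fix i assume "i < dim_vec (combination m J c (\<lambda>j. A *\<^sub>v u j))"
  hence i: "i < m" by (simp add: combination_def)
  have "(A *\<^sub>v combination n J c u) $ i = (\<Sum>a<n. \<Sum>j\<in>J. A $$ (i, a) * (c j * u j $ a))"
    using i by (subst mult_mat_vec_sum[OF A]) (simp_all add: combination_def sum_distrib_left)
  also have "\<dots> = (\<Sum>j\<in>J. \<Sum>a<n. A $$ (i, a) * (c j * u j $ a))"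
    by (rule sum.swap)
  also have "\<dots> = combination m J c (\<lambda>j. A *\<^sub>v u j) $ i"
    using i mult_mat_vec_sum[OF A u i]
    by (simp add: combination_def sum_distrib_left mult_ac del: index_mult_mat_vec)
  finally show "(A *\<^sub>v combination n J c u) $ i = combination m J c (\<lambda>j. A *\<^sub>v u j) $ i" .
qed (use A in \<open>simp add: combination_def\<close>)

section \<open>Extension of an orthonormal system to a basis\<close>

text \<open>The scalar is the reciprocal of the norm of \<open>w\<close>, which is positive because
  \<open>w\<close> is nonzero.\<close>

lemma normalizing_scalar_exists:
  fixes w :: "complex vec"
  assumes w: "w \<in> carrier_vec n" "w \<noteq> 0\<^sub>v n"
  shows "\<exists>t. (t \<cdot>\<^sub>v w) \<bullet>c (t \<cdot>\<^sub>v w) = 1"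
proof -
  define r where "r = (\<Sum>a<n. (cmod (w $ a))\<^sup>2)"
  have ww: "w \<bullet>c w = of_real r"
    unfolding r_def by (rule cscalar_prod_self[OF w(1)])
  have "w \<bullet>c w \<noteq> 0" using conjugate_square_eq_0_vec[OF w(1)] w(2) by metis
  moreover have "r \<ge> 0" unfolding r_def by (intro sum_nonneg) simp
  ultimately have r: "r > 0" using ww by (cases "r = 0") auto
  define t where "t = 1 / sqrt r"
  have "t * t * r = 1" using r by (simp add: t_def field_simps)
  have "(of_real t \<cdot>\<^sub>v w) \<bullet>c (of_real t \<cdot>\<^sub>v w) = of_real t * (cnj (of_real t) * (w \<bullet>c w))"
    using w(1)
    by (subst cscalar_prod_smult_left[of _ n], simp, simp, subst cscalar_prod_smult_right[of _ n]) simp_all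
  also have "\<dots> = of_real (t * t * r)" unfolding ww by simp
  also note \<open>t * t * r = 1\<close>
  finally show ?thesis by (intro exI[of _ "of_real t"]) simp
qed

text \<open>The conjugates of the \<open>u j\<close> serve as rows of a square matrix whose
  remaining rows are zero. Since \<open>J\<close> misses an index, the matrix is singular, and a
  nonzero vector of its kernel is orthogonal to every \<open>u j\<close>; it only has to be
  normalized.\<close>

lemma orthogonal_unit_vector_exists:
  fixes u :: "nat \<Rightarrow> complex vec"
  assumes J: "J \<subset> {..<n}" and u: "\<And>j. j \<in> J \<Longrightarrow> u j \<in> carrier_vec n"
  obtains z where "z \<in> carrier_vec n" "z \<bullet>c z = 1" "\<And>j. j \<in> J \<Longrightarrow> z \<bullet>c u j = 0"
proof -
  define R where "R = mat n n (\<lambda>(i, a). if i \<in> J then cnj (u i $ a) else 0)"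
  have R: "R \<in> carrier_mat n n" by (simp add: R_def)
  obtain k where k: "k < n" "k \<notin> J" using J by auto
  \<comment> \<open>Row \<open>k\<close> of \<open>R\<close> is zero already; the equation merely
    brings \<open>R\<close> into the form to which \<open>det_row_0\<close> applies.\<close>
  have "R = mat\<^sub>r n n (\<lambda>i. if i = k then 0\<^sub>v n else row R i)"
    using k by (intro eq_matI) (auto simp: R_def)
  moreover have "det (mat\<^sub>r n n (\<lambda>i. if i = k then 0\<^sub>v n else row R i)) = 0"
    using R k(1) by (intro det_row_0) auto
  ultimately have "det R = 0" by simp
  then obtain w where w: "w \<in> carrier_vec n" "w \<noteq> 0\<^sub>v n" "R *\<^sub>v w = 0\<^sub>v n"
    using det_0_iff_vec_prod_zero[OF R] by auto
  have orth: "w \<bullet>c u j = 0" if "j \<in> J" for j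
  proof -
    have "j < n" using that J by auto
    then have "(R *\<^sub>v w) $ j = w \<bullet>c u j"
      using that mult_mat_vec_sum[OF R w(1) \<open>j < n\<close>]
      by (simp add: cscalar_prod_sum[OF u[OF that]] R_def mult.commute del: index_mult_mat_vec)
    then show ?thesis using w(3) \<open>j < n\<close> by simp
  qed
  obtain t where t: "(t \<cdot>\<^sub>v w) \<bullet>c (t \<cdot>\<^sub>v w) = 1"
    using normalizing_scalar_exists[OF w(1,2)] by auto
  have "(t \<cdot>\<^sub>v w) \<bullet>c u j = 0" if "j \<in> J" for j
    using orth[OF that] w(1) u[OF that] by (simp add: cscalar_prod_smult_left[of _ n])
  moreover have "t \<cdot>\<^sub>v w \<in> carrier_vec n" using w(1) by simp
  ultimately show thesis using that t by blast
qed

lemma orthonormal_on_insert: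
  assumes u: "orthonormal_on n J u" and k: "k \<notin> J"
    and z: "z \<in> carrier_vec n" "z \<bullet>c z = 1" "\<And>j. j \<in> J \<Longrightarrow> z \<bullet>c u j = 0"
  shows "orthonormal_on n (insert k J) (u(k := z))"
proof -
  have "u j \<bullet>c z = 0" if "j \<in> J" for j
    using cscalar_prod_commute[OF z(1) orthonormal_onD(1)[OF u that]] z(3)[OF that] by simp
  with assms show ?thesis by (auto simp: orthonormal_on_def)
qed

text \<open>The missing indices are filled one at a time, each with a unit vector orthogonal to
  everything chosen before. Vectors at indices in \<open>J\<close> stay where they are, so
  properties tied to the index survive.\<close>

lemma orthonormal_on_extend:
  assumes u: "orthonormal_on n J u" and J: "J \<subseteq> {..<n}"
  obtains u' where "orthonormal_on n {..<n} u'" "\<And>j. j \<in> J \<Longrightarrow> u' j = u j"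
proof -
  have "\<exists>u'. orthonormal_on n (J \<union> K) u' \<and> (\<forall>j\<in>J. u' j = u j)"
    if "finite K" "K \<subseteq> {..<n} - J" for K
    using that
  proof (induction K)
    case empty
    then show ?case using u by auto
  next
    case (insert k K)
    then obtain u' where u': "orthonormal_on n (J \<union> K) u'" "\<forall>j\<in>J. u' j = u j" by auto
    have "J \<union> K \<subset> {..<n}" using insert J by auto
    then obtain z where "z \<in> carrier_vec n" "z \<bullet>c z = 1" "\<And>j. j \<in> J \<union> K \<Longrightarrow> z \<bullet>c u' j = 0"
      using orthogonal_unit_vector_exists[of "J \<union> K" n u'] orthonormal_onD(1)[OF u'(1)] by metis
    from orthonormal_on_insert[OF u'(1) _ this, of k] insert
    have "orthonormal_on n (insert k (J \<union> K)) (u'(k := z))" by auto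
    moreover have "\<forall>j\<in>J. (u'(k := z)) j = u j" using u' insert by auto
    ultimately show ?case by auto
  qed
  from this[of "{..<n} - J"] J that show thesis
    by (auto simp: Un_absorb1)
qed

section \<open>Completeness of an orthonormal basis\<close>

text \<open>\<open>C\<close> has the basis as its columns and \<open>R\<close> is its adjoint.
  Orthonormality is the first equation; a one-sided inverse of a square matrix is two-sided, which
  gives the second and with it completeness.\<close>

lemma orthonormal_basis_matrices:
  assumes u: "orthonormal_on n {..<n} u"
  defines "R \<equiv> mat n n (\<lambda>(i, a). cnj (u i $ a))" and "C \<equiv> mat n n (\<lambda>(a, i). u i $ a)"
  shows "R * C = 1\<^sub>m n" and "C * R = 1\<^sub>m n"
proof -
  have R: "R \<in> carrier_mat n n" and C: "C \<in> carrier_mat n n"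
    by (simp_all add: R_def C_def)
  have uj: "u j \<in> carrier_vec n" if "j < n" for j using u that by (simp add: orthonormal_on_def)
  show "R * C = 1\<^sub>m n"
  proof (rule eq_matI)
    fix i j assume ij: "i < dim_row (1\<^sub>m n :: complex mat)" "j < dim_col (1\<^sub>m n :: complex mat)"
    have "(R * C) $$ (i, j) = u j \<bullet>c u i"
      using ij carrier_vecD[OF uj]
      by (simp add: R_def C_def scalar_prod_def cscalar_prod_sum[OF uj] lessThan_atLeast0 mult.commute)
    then show "(R * C) $$ (i, j) = 1\<^sub>m n $$ (i, j)"
      using ij orthonormal_onD(2)[OF u, of j i] by auto
  qed (simp_all add: R_def C_def)
  then show "C * R = 1\<^sub>m n" using mat_mult_left_right_inverse R C by blast
qed

text \<open>The coordinates of \<open>R *\<^sub>v d\<close> are the inner products of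
  \<open>d\<close> with the basis, so \<open>R\<close> annihilates \<open>d\<close>; applying
  \<open>C\<close> recovers \<open>d\<close>.\<close>

lemma orthonormal_basis_separates:
  assumes u: "orthonormal_on n {..<n} u" and d: "d \<in> carrier_vec n"
    and orth: "\<And>j. j < n \<Longrightarrow> d \<bullet>c u j = 0"
  shows "d = 0\<^sub>v n"
proof -
  define R where "R = mat n n (\<lambda>(i, a). cnj (u i $ a))"
  define C where "C = mat n n (\<lambda>(a, i). u i $ a)"
  have R: "R \<in> carrier_mat n n" and C: "C \<in> carrier_mat n n"
    by (simp_all add: R_def C_def)
  have uj: "u j \<in> carrier_vec n" if "j < n" for j using u that by (simp add: orthonormal_on_def)
  have CR: "C * R = 1\<^sub>m n" unfolding R_def C_def by (rule orthonormal_basis_matrices[OF u])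
  have "R *\<^sub>v d = 0\<^sub>v n"
  proof (rule eq_vecI)
    fix i assume "i < dim_vec (0\<^sub>v n :: complex vec)"
    then have i: "i < n" by simp
    have "(R *\<^sub>v d) $ i = d \<bullet>c u i"
      using i mult_mat_vec_sum[OF R d i]
      by (simp add: cscalar_prod_sum[OF uj] R_def mult.commute del: index_mult_mat_vec)
    then show "(R *\<^sub>v d) $ i = 0\<^sub>v n $ i" using orth i by simp
  qed (use R in simp)
  have "d = (C * R) *\<^sub>v d" using CR d by simp
  also have "\<dots> = C *\<^sub>v (R *\<^sub>v d)" using R C d by simp
  also have "\<dots> = 0\<^sub>v n" using C \<open>R *\<^sub>v d = 0\<^sub>v n\<close> by (auto simp: scalar_prod_def)
  finally show ?thesis .
qed

lemma orthonormal_basis_ext: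
  assumes u: "orthonormal_on n {..<n} u" and x: "x \<in> carrier_vec n" and y: "y \<in> carrier_vec n"
    and eq: "\<And>j. j < n \<Longrightarrow> x \<bullet>c u j = y \<bullet>c u j"
  shows "x = y"
proof -
  have "x - y = 0\<^sub>v n"
    using eq x y orthonormal_onD(1)[OF u]
    by (intro orthonormal_basis_separates[OF u]) (auto simp: cscalar_prod_minus_left[of _ n])
  show ?thesis
  proof (rule eq_vecI)
    fix i assume "i < dim_vec y"
    then have "(x - y) $ i = 0" using \<open>x - y = 0\<^sub>v n\<close> y by simp
    then show "x $ i = y $ i" using \<open>i < dim_vec y\<close> y by simp
  qed (use x y in auto)
qed

text \<open>Both sides have the same inner product with every basis vector.\<close>

lemma orthonormal_basis_expansion:
  assumes u: "orthonormal_on n {..<n} u" and x: "x \<in> carrier_vec n"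
  shows "x = combination n {..<n} (\<lambda>j. x \<bullet>c u j) u"
proof (rule orthonormal_basis_ext[OF u x])
  fix i assume i: "i < n"
  have "combination n {..<n} (\<lambda>j. x \<bullet>c u j) u \<bullet>c u i = (\<Sum>j<n. x \<bullet>c u j * (u j \<bullet>c u i))"
    using orthonormal_onD(1)[OF u] i by (subst combination_cscalar_left) auto
  also have "\<dots> = (\<Sum>j<n. if j = i then x \<bullet>c u j else 0)"
    using orthonormal_onD(2)[OF u] i by (intro sum.cong) auto
  also have "\<dots> = x \<bullet>c u i" using i by simp
  finally show "x \<bullet>c u i = combination n {..<n} (\<lambda>j. x \<bullet>c u j) u \<bullet>c u i" by simp
qed simp

section \<open>Spectral theorem for self-adjoint matrices\<close>

text \<open>Induction on the number \<open>m\<close> of orthonormal eigenvectors found. The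
  eigenvalues \<open>l\<close> are typed as complex numbers; for \<open>mat_adjoint A * A\<close>
  they are later identified with squared norms, hence real and nonnegative.\<close>

lemma hermitian_eigenbasis_exists:
  assumes H: "H \<in> carrier_mat n n"
    and herm: "\<And>x y. x \<in> carrier_vec n \<Longrightarrow> y \<in> carrier_vec n \<Longrightarrow> (H *\<^sub>v x) \<bullet>c y = x \<bullet>c (H *\<^sub>v y)"
  obtains v l where "orthonormal_on n {..<n} v" "\<And>j. j < n \<Longrightarrow> H *\<^sub>v v j = l j \<cdot>\<^sub>v v j"
proof -
  have "\<exists>v l. orthonormal_on n {..<m} v \<and> (\<forall>j<m. H *\<^sub>v v j = l j \<cdot>\<^sub>v v j)" if "m \<le> n" for m
    using that
  proof (induction m)
    case 0
    show ?case by (simp add: orthonormal_on_def)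
  next
    case (Suc m)
    then obtain v l where v: "orthonormal_on n {..<m} v" and l: "\<forall>j<m. H *\<^sub>v v j = l j \<cdot>\<^sub>v v j"
      by auto
    obtain e where e: "orthonormal_on n {..<n} e" and ev: "\<And>j. j \<in> {..<m} \<Longrightarrow> e j = v j"
      using orthonormal_on_extend[OF v] Suc.prems by auto
    have ec: "e j \<in> carrier_vec n" if "j < n" for j using e that by (simp add: orthonormal_on_def)
    have ee: "e i \<bullet>c e j = (if i = j then 1 else 0)" if "i < n" "j < n" for i j
      using orthonormal_onD(2)[OF e] that by simp
    \<comment> \<open>\<open>H\<close> leaves the complement of the eigenvectors found so far invariant, so an eigenvector of
      its compression \<open>B\<close> to that complement is one of \<open>H\<close>.\<close>
    define B where "B = mat (n - m) (n - m) (\<lambda>(i, j). (H *\<^sub>v e (m + j)) \<bullet>c e (m + i))"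
    have B: "B \<in> carrier_mat (n - m) (n - m)" by (simp add: B_def)
    \<comment> \<open>\<open>Suc m \<le> n\<close> makes the dimension \<open>n - m\<close>
      positive, so the complex matrix \<open>B\<close> has an eigenvalue.\<close>
    obtain \<mu> z where z: "z \<in> carrier_vec (n - m)" "z \<noteq> 0\<^sub>v (n - m)" and Bz: "B *\<^sub>v z = \<mu> \<cdot>\<^sub>v z"
      using spectrum_non_empty[OF B] Suc.prems B
      by (auto simp: spectrum_def eigenvalue_def eigenvector_def)
    \<comment> \<open>The eigenvector \<open>z\<close> of the compression, lifted back: its entries
      become the coordinates along \<open>e m\<close>, ..., \<open>e (n - 1)\<close>.\<close>
    define w where "w = combination n {..<n - m} (\<lambda>j. z $ j) (\<lambda>j. e (m + j))"
    have w: "w \<in> carrier_vec n" by (simp add: w_def)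
    have w_low: "w \<bullet>c e i = 0" if "i < m" for i
    proof -
      have "w \<bullet>c e i = (\<Sum>j<n - m. z $ j * (e (m + j) \<bullet>c e i))"
        unfolding w_def using that Suc.prems by (intro combination_cscalar_left) (auto intro: ec)
      also have "\<dots> = 0" using that Suc.prems by (intro sum.neutral) (auto simp: ee)
      finally show ?thesis .
    qed
    have w_high: "w \<bullet>c e (m + a) = z $ a" if "a < n - m" for a
    proof -
      have "w \<bullet>c e (m + a) = (\<Sum>j<n - m. z $ j * (e (m + j) \<bullet>c e (m + a)))"
        unfolding w_def using that by (intro combination_cscalar_left) (auto intro: ec)
      also have "\<dots> = (\<Sum>j<n - m. if j = a then z $ j else 0)"
        using that by (intro sum.cong) (auto simp: ee)
      finally show ?thesis using that by simp
    qed
    \<comment> \<open>The equation is tested against the basis \<open>e\<close>. For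
      \<open>i < m\<close> both sides vanish, since \<open>e i\<close> is an eigenvector orthogonal
      to \<open>w\<close>; for the other indices it is the eigenvalue equation of
      \<open>B\<close>.\<close>
    have Hw: "H *\<^sub>v w = \<mu> \<cdot>\<^sub>v w"
    proof (rule orthonormal_basis_ext[OF e])
      fix i assume i: "i < n"
      show "(H *\<^sub>v w) \<bullet>c e i = (\<mu> \<cdot>\<^sub>v w) \<bullet>c e i"
      proof (cases "i < m")
        case True
        have "(H *\<^sub>v w) \<bullet>c e i = w \<bullet>c (H *\<^sub>v e i)" using herm[OF w ec[OF i]] .
        also have "H *\<^sub>v e i = l i \<cdot>\<^sub>v e i" using l ev True by simp
        finally show ?thesis using w_low[OF True] w ec[OF i]
          by (simp add: cscalar_prod_smult_left[of _ n] cscalar_prod_smult_right[of _ n])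
      next
        case False
        define a where "a = i - m"
        have a: "a < n - m" "i = m + a" using False i by (auto simp: a_def)
        have "(H *\<^sub>v w) \<bullet>c e i = (\<Sum>j<n - m. z $ j * ((H *\<^sub>v e (m + j)) \<bullet>c e i))"
          unfolding w_def using ec[OF i] mult_mat_vec_carrier[OF H ec]
          by (subst mult_mat_combination[OF H]) (auto intro: ec intro!: combination_cscalar_left)
        also have "\<dots> = (B *\<^sub>v z) $ a"
          using a mult_mat_vec_sum[OF B z(1) a(1)]
          by (simp add: B_def mult.commute del: index_mult_mat_vec)
        also have "\<dots> = \<mu> * (w \<bullet>c e i)" using Bz w_high[OF a(1)] a z(1) by simp
        finally show ?thesis using w ec[OF i] by (simp add: cscalar_prod_smult_left[of _ n])
      qed
    qed (use w H in auto)
    have "w \<noteq> 0\<^sub>v n"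
    proof
      assume "w = 0\<^sub>v n"
      then have "z $ a = 0" if "a < n - m" for a
        using w_high[OF that] ec[of "m + a"] that by (simp add: cscalar_prod_sum[of _ n])
      then have "z = 0\<^sub>v (n - m)" using z(1) by (intro eq_vecI) auto
      with z(2) show False by simp
    qed
    then obtain t where t: "(t \<cdot>\<^sub>v w) \<bullet>c (t \<cdot>\<^sub>v w) = 1"
      using normalizing_scalar_exists[OF w] by auto
    have "orthonormal_on n (insert m {..<m}) (v(m := t \<cdot>\<^sub>v w))"
    proof (rule orthonormal_on_insert[OF v _ _ t])
      fix j assume "j \<in> {..<m}"
      then show "(t \<cdot>\<^sub>v w) \<bullet>c v j = 0"
        using w_low[of j] w orthonormal_onD(1)[OF v] ev[of j]
        by (simp add: cscalar_prod_smult_left[of _ n])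
    qed (use w in auto)
    moreover have "H *\<^sub>v (t \<cdot>\<^sub>v w) = \<mu> \<cdot>\<^sub>v (t \<cdot>\<^sub>v w)"
      using Hw H w by (simp add: mult_mat_vec smult_smult_assoc mult.commute)
    then have "\<forall>j<Suc m. H *\<^sub>v (v(m := t \<cdot>\<^sub>v w)) j = (l(m := \<mu>)) j \<cdot>\<^sub>v (v(m := t \<cdot>\<^sub>v w)) j"
      using l by (auto simp: less_Suc_eq)
    ultimately show ?case by (metis lessThan_Suc)
  qed
  from this[of n] that show thesis by auto
qed

subsection \<open>Singular value decomposition and the Ky Fan bound\<close>

text \<open>A singular value decomposition in terms of vectors: \<open>v\<close> are the right and
  \<open>u\<close> the left singular vectors. The values \<open>s\<close> come in no particular
  order, so that two systems can be joined end to end; sorting is a separate reindexing.\<close>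

definition singular_system ::
    "nat \<Rightarrow> complex mat \<Rightarrow> (nat \<Rightarrow> complex vec) \<Rightarrow> (nat \<Rightarrow> complex vec) \<Rightarrow> (nat \<Rightarrow> real) \<Rightarrow> bool" where
  "singular_system n M v u s \<longleftrightarrow>
     orthonormal_on n {..<n} v \<and> orthonormal_on n {..<n} u \<and>
     (\<forall>j<n. 0 \<le> s j \<and> M *\<^sub>v v j = of_real (s j) \<cdot>\<^sub>v u j)"

text \<open>\<open>v\<close> is an eigenbasis of \<open>mat_adjoint A * A\<close> and
  \<open>s j\<close> the square root of the \<open>j\<close>-th eigenvalue. Where \<open>s j\<close>
  is nonzero, \<open>u j\<close> is the image of \<open>v j\<close> divided by \<open>s j\<close>;
  these vectors are orthonormal and are completed to a basis. Where \<open>s j\<close> is zero,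
  \<open>A\<close> annihilates \<open>v j\<close>, so any completion will do.\<close>

lemma singular_system_exists:
  assumes A: "A \<in> carrier_mat n n"
  obtains v u s where "singular_system n A v u s"
proof -
  define H where "H = mat_adjoint A * A"
  have H: "H \<in> carrier_mat n n" using A mat_adjoint_carrier[OF A] by (simp add: H_def)
  have Hx: "H *\<^sub>v x = mat_adjoint A *\<^sub>v (A *\<^sub>v x)" if "x \<in> carrier_vec n" for x
    using that A mat_adjoint_carrier[OF A] by (simp add: H_def)
  have Hxy: "(H *\<^sub>v x) \<bullet>c y = (A *\<^sub>v x) \<bullet>c (A *\<^sub>v y)" if "x \<in> carrier_vec n" "y \<in> carrier_vec n" for x y
    using that A by (simp add: Hx cscalar_prod_mat_adjoint[of A n n])
  have herm: "(H *\<^sub>v x) \<bullet>c y = x \<bullet>c (H *\<^sub>v y)" if "x \<in> carrier_vec n" "y \<in> carrier_vec n" for x y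
  proof -
    have "x \<bullet>c (H *\<^sub>v y) = cnj ((H *\<^sub>v y) \<bullet>c x)"
      using H that by (intro cscalar_prod_commute[of _ n]) auto
    also have "\<dots> = cnj ((A *\<^sub>v y) \<bullet>c (A *\<^sub>v x))" using Hxy that by simp
    also have "\<dots> = (A *\<^sub>v x) \<bullet>c (A *\<^sub>v y)"
      using A that by (intro cscalar_prod_commute[of _ n, symmetric]) auto
    finally show ?thesis using Hxy that by simp
  qed
  obtain v l where v: "orthonormal_on n {..<n} v" and l: "\<And>j. j < n \<Longrightarrow> H *\<^sub>v v j = l j \<cdot>\<^sub>v v j"
    using hermitian_eigenbasis_exists[OF H herm] by blast
  have vc: "v j \<in> carrier_vec n" if "j < n" for j using v that by (simp add: orthonormal_on_def)
  have Avc: "A *\<^sub>v v j \<in> carrier_vec n" if "j < n" for j using A vc[OF that] by simp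
  \<comment> \<open>The images of the eigenvectors are pairwise orthogonal, and \<open>l i\<close>
    is the squared norm of the \<open>i\<close>-th image. This is what makes the eigenvalues real
    and nonnegative.\<close>
  have gram: "(A *\<^sub>v v i) \<bullet>c (A *\<^sub>v v j) = (if i = j then l i else 0)" if "i < n" "j < n" for i j
    using Hxy[OF vc vc, OF that] l[OF that(1)] that orthonormal_onD(2)[OF v, of i j]
    by (simp add: cscalar_prod_smult_left[OF vc vc] split: if_splits)
  define s where "s j = sqrt (Re (l j))" for j
  have l_eq: "l j = of_real (s j * s j)" if j: "j < n" for j
  proof -
    define r where "r = (\<Sum>a<n. (cmod ((A *\<^sub>v v j) $ a))\<^sup>2)"
    have "l j = of_real r"
      using gram[OF j j] cscalar_prod_self[OF Avc[OF j]] by (simp add: r_def)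
    moreover have "r \<ge> 0" unfolding r_def by (intro sum_nonneg) simp
    ultimately show ?thesis by (simp add: s_def del: of_real_mult)
  qed
  have s_nonneg: "s j \<ge> 0" if j: "j < n" for j
  proof -
    have "Re (l j) = s j * s j" unfolding l_eq[OF j] by (rule Re_complex_of_real)
    then have "0 \<le> Re (l j)" by simp
    then show ?thesis unfolding s_def by (rule real_sqrt_ge_zero)
  qed
  define J where "J = {j. j < n \<and> s j \<noteq> 0}"
  define u0 where "u0 j = of_real (1 / s j) \<cdot>\<^sub>v (A *\<^sub>v v j)" for j
  have "orthonormal_on n J u0"
    unfolding orthonormal_on_def
  proof (intro conjI ballI)
    fix i j assume ij: "i \<in> J" "j \<in> J"
    then have i: "i < n" and j: "j < n" by (auto simp: J_def)
    have "u0 i \<bullet>c u0 j = of_real (1 / s i) * (of_real (1 / s j) * ((A *\<^sub>v v i) \<bullet>c (A *\<^sub>v v j)))"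
      unfolding u0_def using Avc[OF i] Avc[OF j]
      by (subst cscalar_prod_smult_left[of _ n], simp, simp, subst cscalar_prod_smult_right[of _ n]) simp_all
    also have "\<dots> = (if i = j then 1 else 0)"
      using gram[OF i j] l_eq[OF j] ij by (auto simp: J_def)
    finally show "u0 i \<bullet>c u0 j = (if i = j then 1 else 0)" .
  qed (use Avc in \<open>auto simp: u0_def J_def\<close>)
  then obtain u where u: "orthonormal_on n {..<n} u" and uJ: "\<And>j. j \<in> J \<Longrightarrow> u j = u0 j"
    using orthonormal_on_extend[of n J u0] by (auto simp: J_def)
  have "A *\<^sub>v v j = of_real (s j) \<cdot>\<^sub>v u j" if j: "j < n" for j
  proof (cases "s j = 0")
    case True
    then have "(A *\<^sub>v v j) \<bullet>c (A *\<^sub>v v j) = 0" using gram[OF j j] l_eq[OF j] by simp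
    then have "A *\<^sub>v v j = 0\<^sub>v n" using conjugate_square_eq_0_vec[OF Avc[OF j]] by metis
    then show ?thesis using True orthonormal_onD(1)[OF u, of j] j by auto
  next
    case False
    then have "u j = of_real (1 / s j) \<cdot>\<^sub>v (A *\<^sub>v v j)" using uJ[of j] j by (simp add: J_def u0_def)
    then show ?thesis using False by (simp add: smult_smult_assoc del: of_real_divide flip: of_real_mult)
  qed
  with v u s_nonneg have "singular_system n A v u s" by (simp add: singular_system_def)
  with that show thesis .
qed

lemma singular_system_permute:
  assumes "singular_system n M v u s" "bij_betw p {..<n} {..<n}"
  shows "singular_system n M (v \<circ> p) (u \<circ> p) (s \<circ> p)"
proof -
  have "p j < n" if "j < n" for j using assms(2) that by (auto simp: bij_betw_def)
  with assms show ?thesis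
    by (auto simp: singular_system_def bij_betw_def intro!: orthonormal_on_reindex[of n "{..<n}"])
qed

section \<open>Bessel's inequality and Ky Fan's inequality\<close>

text \<open>Let \<open>p\<close> be the orthogonal projection of \<open>z\<close> onto the span of
  the family. Then \<open>p\<close> is orthogonal to \<open>z - p\<close>, so the squared norm of
  \<open>z - p\<close> is 1 minus the sum in question, and it is nonnegative.\<close>

lemma bessel_inequality:
  assumes x: "orthonormal_on n I x" and I: "finite I" and z: "z \<in> carrier_vec n" "z \<bullet>c z = 1"
  shows "(\<Sum>i\<in>I. (cmod (z \<bullet>c x i))\<^sup>2) \<le> 1"
proof -
  define p where "p = combination n I (\<lambda>i. z \<bullet>c x i) x"
  have p: "p \<in> carrier_vec n" by (simp add: p_def)
  have xc: "x i \<in> carrier_vec n" if "i \<in> I" for i using x that by (simp add: orthonormal_on_def)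
  have "(z - p) \<bullet>c x i = 0" if i: "i \<in> I" for i
  proof -
    have "p \<bullet>c x i = (\<Sum>j\<in>I. z \<bullet>c x j * (x j \<bullet>c x i))"
      unfolding p_def by (intro combination_cscalar_left) (use xc i in auto)
    also have "\<dots> = (\<Sum>j\<in>I. if j = i then z \<bullet>c x j else 0)"
      using orthonormal_onD(2)[OF x] i by (intro sum.cong) auto
    also have "\<dots> = z \<bullet>c x i" using I i by simp
    finally show ?thesis using z p xc[OF i] by (simp add: cscalar_prod_minus_left[of _ n])
  qed
  then have "x i \<bullet>c (z - p) = 0" if i: "i \<in> I" for i
    using that z p xc[OF i] by (subst cscalar_prod_commute[of "z - p" n]) auto
  then have "p \<bullet>c (z - p) = 0"
    unfolding p_def using z p xc by (subst combination_cscalar_left) (auto simp: p_def)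
  then have orth: "(z - p) \<bullet>c p = 0"
    using z p by (subst cscalar_prod_commute[of p n]) auto
  have "p \<bullet>c z = (\<Sum>i\<in>I. z \<bullet>c x i * (x i \<bullet>c z))"
    unfolding p_def by (intro combination_cscalar_left) (use xc z in auto)
  also have "\<dots> = (\<Sum>i\<in>I. z \<bullet>c x i * cnj (z \<bullet>c x i))"
    using cscalar_prod_commute[OF z(1) xc] by (intro sum.cong) auto
  also have "\<dots> = of_real (\<Sum>i\<in>I. (cmod (z \<bullet>c x i))\<^sup>2)"
    by (simp only: complex_norm_square of_real_sum)
  finally have pz: "p \<bullet>c z = of_real (\<Sum>i\<in>I. (cmod (z \<bullet>c x i))\<^sup>2)" .
  have "p \<bullet>c p = z \<bullet>c p" using orth z p by (simp add: cscalar_prod_minus_left[of _ n])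
  also have "\<dots> = cnj (p \<bullet>c z)" using cscalar_prod_commute[OF p z(1)] .
  also have "\<dots> = p \<bullet>c z" using pz by simp
  finally have pp: "p \<bullet>c p = p \<bullet>c z" .
  have zp: "z \<bullet>c p = p \<bullet>c z" using cscalar_prod_commute[OF p z(1)] pz by simp
  have "(z - p) \<bullet>c (z - p) = z \<bullet>c (z - p) - p \<bullet>c (z - p)"
    using z p by (intro cscalar_prod_minus_left[of _ n]) auto
  also have "\<dots> = z \<bullet>c (z - p)" using \<open>p \<bullet>c (z - p) = 0\<close> by simp
  also have "\<dots> = cnj ((z - p) \<bullet>c z)" using z p by (intro cscalar_prod_commute[of _ n]) auto
  also have "\<dots> = cnj (1 - p \<bullet>c z)" using z p by (simp add: cscalar_prod_minus_left[of _ n])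
  finally have "(z - p) \<bullet>c (z - p) = of_real (1 - (\<Sum>i\<in>I. (cmod (z \<bullet>c x i))\<^sup>2))"
    unfolding pz by simp
  moreover have "(z - p) \<bullet>c (z - p) = of_real (\<Sum>a<n. (cmod ((z - p) $ a))\<^sup>2)"
    using z p by (intro cscalar_prod_self) auto
  ultimately have "1 - (\<Sum>i\<in>I. (cmod (z \<bullet>c x i))\<^sup>2) = (\<Sum>a<n. (cmod ((z - p) $ a))\<^sup>2)"
    using of_real_eq_iff by metis
  also have "\<dots> \<ge> 0" by (intro sum_nonneg) simp
  finally show ?thesis by simp
qed

text \<open>Weights in the unit interval do best when concentrated on the first \<open>k\<close>
  entries. The product form of \<open>total\<close> covers two uses: total weight at most
  \<open>k\<close> with nonnegative \<open>s\<close>, and total weight exactly \<open>k\<close> with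
  entries of any sign.\<close>

lemma weighted_sum_le_top_sum:
  fixes s w :: "nat \<Rightarrow> real"
  assumes k: "1 \<le> k" "k \<le> n"
    and s: "\<And>i j. i \<le> j \<Longrightarrow> j < n \<Longrightarrow> s j \<le> s i"
    and w: "\<And>j. j < n \<Longrightarrow> 0 \<le> w j" "\<And>j. j < n \<Longrightarrow> w j \<le> 1"
    and total: "s (k - 1) * (sum w {..<n} - real k) \<le> 0"
  shows "(\<Sum>j<n. s j * w j) \<le> (\<Sum>j<k. s j)"
proof -
  define t where "t = s (k - 1)"
  define c where "c j = (if j < k then 1 else 0 :: real)" for j
  have sub: "{..<n} \<inter> {j. j < k} = {..<k}" using k by auto
  have sc: "(\<Sum>j<n. s j * c j) = (\<Sum>j<k. s j)"
  proof -
    have "(\<Sum>j<n. s j * c j) = (\<Sum>j<n. if j < k then s j else 0)" by (simp add: c_def if_distrib cong: if_cong)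
    also have "\<dots> = sum s ({..<n} \<inter> {j. j < k})" by (simp add: sum.inter_restrict)
    finally show ?thesis using sub by simp
  qed
  have cn: "sum c {..<n} = real k"
    using sub sum.inter_restrict[of "{..<n}" "\<lambda>_. 1::real" "{j. j < k}"] by (simp add: c_def)
  \<comment> \<open>Moving weight from indices below \<open>k\<close> to later ones only loses.\<close>
  have "(s j - t) * (w j - c j) \<le> 0" if j: "j < n" for j
  proof (cases "j < k")
    case True
    then have "s j \<ge> t" using s[of j "k - 1"] k by (simp add: t_def)
    then show ?thesis using w[OF j] True by (intro mult_nonneg_nonpos) (auto simp: c_def)
  next
    case False
    then have "s j \<le> t" using s[of "k - 1" j] j by (simp add: t_def)
    then show ?thesis using w[OF j] False by (intro mult_nonpos_nonneg) (auto simp: c_def)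
  qed
  \<comment> \<open>Expanding the product isolates \<open>t\<close> times the excess of the total
    weight over \<open>k\<close>, which \<open>total\<close> bounds by zero.\<close>
  then have "(\<Sum>j<n. (s j - t) * (w j - c j)) \<le> 0" by (intro sum_nonpos) auto
  also have "(\<Sum>j<n. (s j - t) * (w j - c j)) =
      (\<Sum>j<n. s j * w j) - (\<Sum>j<n. s j * c j) - t * (sum w {..<n} - sum c {..<n})"
    by (simp add: algebra_simps sum.distrib sum_subtractf sum_distrib_left)
  finally show ?thesis using total unfolding sc cn t_def by simp
qed

text \<open>The upper half of Ky Fan's maximum principle. It holds for all pairs of orthonormal
  families, in particular for those admissible in the discrepancy seminorm.\<close>

lemma ky_fan_upper_bound:
  assumes M: "M \<in> carrier_mat n n" and sys: "singular_system n M v u s"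
    and anti: "\<And>i j. i \<le> j \<Longrightarrow> j < n \<Longrightarrow> s j \<le> s i"
    and k: "1 \<le> k" "k \<le> n" and I: "finite I" "card I = k"
    and x: "orthonormal_on n I x" and y: "orthonormal_on n I y"
  shows "cmod (\<Sum>i\<in>I. (M *\<^sub>v x i) \<bullet>c y i) \<le> (\<Sum>j<k. s j)"
proof -
  have v: "orthonormal_on n {..<n} v" and u: "orthonormal_on n {..<n} u"
    and s: "\<And>j. j < n \<Longrightarrow> 0 \<le> s j" and Mv: "\<And>j. j < n \<Longrightarrow> M *\<^sub>v v j = of_real (s j) \<cdot>\<^sub>v u j"
    using sys by (auto simp: singular_system_def)
  have vc: "v j \<in> carrier_vec n" and uc: "u j \<in> carrier_vec n" if "j < n" for j
    using that v u by (auto simp: orthonormal_on_def)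
  have xc: "x i \<in> carrier_vec n" and yc: "y i \<in> carrier_vec n" if "i \<in> I" for i
    using that x y by (auto simp: orthonormal_on_def)
  \<comment> \<open>By AM-GM the left side is at most \<open>\<Sum>j. s j * w j\<close>; Bessel's inequality for the four families
    gives \<open>w j \<le> 1\<close> and total weight at most \<open>k\<close>.\<close>
  define w where "w j = (\<Sum>i\<in>I. ((cmod (x i \<bullet>c v j))\<^sup>2 + (cmod (u j \<bullet>c y i))\<^sup>2) / 2)" for j
  \<comment> \<open>\<open>x i\<close> is expanded in the right singular vectors, and
    \<open>M\<close> turns each \<open>v j\<close> into \<open>s j\<close> times
    \<open>u j\<close>.\<close>
  have expand: "(M *\<^sub>v x i) \<bullet>c y i = (\<Sum>j<n. (x i \<bullet>c v j) * (of_real (s j) * (u j \<bullet>c y i)))"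
    if i: "i \<in> I" for i
  proof -
    have "M *\<^sub>v x i = M *\<^sub>v combination n {..<n} (\<lambda>j. x i \<bullet>c v j) v"
      using orthonormal_basis_expansion[OF v xc[OF i]] by simp
    also have "\<dots> = combination n {..<n} (\<lambda>j. x i \<bullet>c v j) (\<lambda>j. M *\<^sub>v v j)"
      by (rule mult_mat_combination[OF M]) (use vc in auto)
    finally have "(M *\<^sub>v x i) \<bullet>c y i = (\<Sum>j<n. (x i \<bullet>c v j) * ((M *\<^sub>v v j) \<bullet>c y i))"
      using combination_cscalar_left[OF yc[OF i], of "{..<n}" "\<lambda>j. M *\<^sub>v v j"]
        mult_mat_vec_carrier[OF M vc] by simp
    also have "\<dots> = (\<Sum>j<n. (x i \<bullet>c v j) * (of_real (s j) * (u j \<bullet>c y i)))"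
      using yc[OF i] uc by (intro sum.cong) (auto simp: Mv cscalar_prod_smult_left[of _ n])
    finally show ?thesis .
  qed
  have "cmod (\<Sum>i\<in>I. (M *\<^sub>v x i) \<bullet>c y i) \<le> (\<Sum>i\<in>I. cmod ((M *\<^sub>v x i) \<bullet>c y i))"
    by (rule norm_sum)
  also have "\<dots> \<le> (\<Sum>i\<in>I. \<Sum>j<n. s j * (((cmod (x i \<bullet>c v j))\<^sup>2 + (cmod (u j \<bullet>c y i))\<^sup>2) / 2))"
  proof (rule sum_mono)
    fix i assume i: "i \<in> I"
    have "cmod ((M *\<^sub>v x i) \<bullet>c y i) \<le> (\<Sum>j<n. cmod ((x i \<bullet>c v j) * (of_real (s j) * (u j \<bullet>c y i))))"
      unfolding expand[OF i] by (rule norm_sum)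
    also have "\<dots> \<le> (\<Sum>j<n. s j * (((cmod (x i \<bullet>c v j))\<^sup>2 + (cmod (u j \<bullet>c y i))\<^sup>2) / 2))"
    proof (rule sum_mono)
      fix j assume "j \<in> {..<n}"
      then have sj: "0 \<le> s j" using s by simp
      have "cmod (x i \<bullet>c v j) * cmod (u j \<bullet>c y i) \<le> ((cmod (x i \<bullet>c v j))\<^sup>2 + (cmod (u j \<bullet>c y i))\<^sup>2) / 2"
        using sum_squares_bound[of "cmod (x i \<bullet>c v j)" "cmod (u j \<bullet>c y i)"] by simp
      from mult_left_mono[OF this sj]
      show "cmod ((x i \<bullet>c v j) * (of_real (s j) * (u j \<bullet>c y i)))
          \<le> s j * (((cmod (x i \<bullet>c v j))\<^sup>2 + (cmod (u j \<bullet>c y i))\<^sup>2) / 2)"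
        using sj by (simp only: norm_mult norm_of_real abs_of_nonneg mult_ac)
    qed
    finally show "cmod ((M *\<^sub>v x i) \<bullet>c y i) \<le> \<dots>" .
  qed
  also have "\<dots> = (\<Sum>j<n. s j * w j)"
    unfolding w_def sum_distrib_left by (rule sum.swap)
  also have "\<dots> \<le> (\<Sum>j<k. s j)"
  proof (rule weighted_sum_le_top_sum[OF k anti])
    fix j assume j: "j < n"
    show "0 \<le> w j" unfolding w_def by (intro sum_nonneg) simp
    have "(\<Sum>i\<in>I. (cmod (v j \<bullet>c x i))\<^sup>2) \<le> 1"
      using bessel_inequality[OF x I(1) vc[OF j]] orthonormal_onD(2)[OF v, of j j] j by simp
    moreover have "cmod (v j \<bullet>c x i) = cmod (x i \<bullet>c v j)" if "i \<in> I" for i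
      using cscalar_prod_commute[OF xc[OF that] vc[OF j]] by simp
    moreover have "(\<Sum>i\<in>I. (cmod (u j \<bullet>c y i))\<^sup>2) \<le> 1"
      using bessel_inequality[OF y I(1) uc[OF j]] orthonormal_onD(2)[OF u, of j j] j by simp
    ultimately show "w j \<le> 1"
      unfolding w_def by (simp add: sum.distrib flip: sum_divide_distrib)
  next
    have "sum w {..<n} = (\<Sum>i\<in>I. \<Sum>j<n. ((cmod (x i \<bullet>c v j))\<^sup>2 + (cmod (u j \<bullet>c y i))\<^sup>2) / 2)"
      unfolding w_def by (rule sum.swap)
    also have "\<dots> \<le> (\<Sum>i\<in>I. 1)"
    proof (rule sum_mono)
      fix i assume i: "i \<in> I"
      have "(\<Sum>j<n. (cmod (x i \<bullet>c v j))\<^sup>2) \<le> 1"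
        using bessel_inequality[OF v _ xc[OF i]] orthonormal_onD(2)[OF x i i] by simp
      moreover have "(\<Sum>j<n. (cmod (y i \<bullet>c u j))\<^sup>2) \<le> 1"
        using bessel_inequality[OF u _ yc[OF i]] orthonormal_onD(2)[OF y i i] by simp
      moreover have "cmod (u j \<bullet>c y i) = cmod (y i \<bullet>c u j)" if "j < n" for j
        using cscalar_prod_commute[OF yc[OF i] uc[OF that]] by simp
      ultimately show "(\<Sum>j<n. ((cmod (x i \<bullet>c v j))\<^sup>2 + (cmod (u j \<bullet>c y i))\<^sup>2) / 2) \<le> 1"
        by (simp add: sum.distrib flip: sum_divide_distrib)
    qed
    finally have "sum w {..<n} \<le> real k" using I by simp
    moreover have "0 \<le> s (k - 1)" using s k by simp
    ultimately show "s (k - 1) * (sum w {..<n} - real k) \<le> 0"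
      by (intro mult_nonneg_nonpos) auto
  qed
  finally show ?thesis .
qed

subsection \<open>Singular values as a sorted list\<close>

text \<open>The matrix \<open>C\<close> with columns \<open>v j\<close> conjugates \<open>H\<close>
  to the diagonal matrix \<open>D\<close> of the \<open>l j\<close>. Similarity yields the
  eigenvalues with algebraic multiplicity, as the definition of \<open>singular_values\<close>
  counts them.\<close>

lemma char_poly_orthonormal_eigenbasis:
  assumes H: "H \<in> carrier_mat n n" and v: "orthonormal_on n {..<n} v"
    and l: "\<And>j. j < n \<Longrightarrow> H *\<^sub>v v j = l j \<cdot>\<^sub>v v j"
  shows "char_poly H = (\<Prod>j\<leftarrow>[0..<n]. [:- l j, 1:])"
proof -
  define R where "R = mat n n (\<lambda>(i, a). cnj (v i $ a))"
  define C where "C = mat n n (\<lambda>(a, i). v i $ a)"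
  define D where "D = mat n n (\<lambda>(i, j). if i = j then l i else 0)"
  have carrier: "R \<in> carrier_mat n n" "C \<in> carrier_mat n n" "D \<in> carrier_mat n n"
    by (simp_all add: R_def C_def D_def)
  have inv: "R * C = 1\<^sub>m n" "C * R = 1\<^sub>m n"
    unfolding R_def C_def by (rule orthonormal_basis_matrices[OF v])+
  have "H * C = C * D"
  proof (rule eq_matI)
    fix a j assume "a < dim_row (C * D)" "j < dim_col (C * D)"
    then have aj: "a < n" "j < n" using carrier by auto
    have vj: "v j \<in> carrier_vec n" using v aj by (simp add: orthonormal_on_def)
    have "col C j = v j" using aj vj by (intro eq_vecI) (auto simp: C_def)
    then have "(H * C) $$ (a, j) = (H *\<^sub>v v j) $ a" using H carrier aj by simp
    also have "\<dots> = l j * v j $ a" using l aj vj by simp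
    also have "\<dots> = (\<Sum>i\<in>{0..<n}. if i = j then v i $ a * l i else 0)" using aj by simp
    also have "\<dots> = (\<Sum>i\<in>{0..<n}. v i $ a * (if i = j then l i else 0))"
      by (intro sum.cong) auto
    also have "\<dots> = (C * D) $$ (a, j)"
      using aj by (simp add: C_def D_def scalar_prod_def)
    finally show "(H * C) $$ (a, j) = (C * D) $$ (a, j)" .
  qed (use H carrier in auto)
  have "H = H * (C * R)" using H inv by simp
  also have "\<dots> = H * C * R" using H carrier by (simp only: assoc_mult_mat)
  finally have "H = C * D * R" unfolding \<open>H * C = C * D\<close> .
  then have "similar_mat H D"
    using H carrier inv by (intro similar_matI[of H D C R n]) auto
  then have "char_poly H = char_poly D" by (rule char_poly_similar)
  also have "\<dots> = (\<Prod>a\<leftarrow>diag_mat D. [:- a, 1:])"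
    by (intro char_poly_upper_triangular[of _ n]) (auto simp: D_def)
  also have "diag_mat D = map l [0..<n]"
    by (auto simp: diag_mat_def D_def)
  finally show ?thesis by (simp only: list.map_comp comp_def)
qed

lemma proots_prod_linear_factors:
  fixes l :: "'b \<Rightarrow> 'a :: idom"
  shows "proots (\<Prod>j\<leftarrow>xs. [:- l j, 1:]) = mset (map l xs)"
proof (induction xs)
  case (Cons a xs)
  have "(\<Prod>j\<leftarrow>xs. [:- l j, 1:]) \<noteq> 0" and "[:- l a, 1:] \<noteq> 0"
    by (auto simp: prod_list_zero_iff)
  then have "proots ([:- l a, 1:] * (\<Prod>j\<leftarrow>xs. [:- l j, 1:])) = {#l a#} + mset (map l xs)"
    using Cons.IH by (subst proots_mult) (assumption | simp only: proots_linear_factor minus_minus)+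
  then show ?case by (simp only: list.map prod_list.Cons mset.simps union_mset_add_mset_left add_0)
qed simp

section \<open>Decreasing rearrangements and their prefix sums\<close>

lemma decreasing_rearrangement_fixed:
  assumes "\<And>i j. i \<le> j \<Longrightarrow> j < n \<Longrightarrow> s j \<le> s i"
  shows "decreasing_rearrangement (map s [0..<n]) = map s [0..<n]"
proof -
  have "sorted (rev (map s [0..<n]))"
    using assms unfolding sorted_rev_iff_nth_mono by simp
  then have "sort (map s [0..<n]) = rev (map s [0..<n])"
    by (intro properties_for_sort) simp_all
  then show ?thesis by (simp add: decreasing_rearrangement_def)
qed

text \<open>\<open>discrepancy_values\<close> is sorted by definition and weak majorization sorts it
  again.\<close>

lemma decreasing_rearrangement_idem:
  "decreasing_rearrangement (decreasing_rearrangement xs) = decreasing_rearrangement xs"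
proof -
  have "sort (rev (sort xs)) = sort xs" by (intro properties_for_sort) simp_all
  then show ?thesis by (simp add: decreasing_rearrangement_def)
qed

text \<open>An explicit sorting permutation is what allows singular vectors to be reordered together
  with their values.\<close>

lemma decreasing_rearrangement_permutation:
  "\<exists>p. bij_betw p {..<n} {..<n} \<and>
     decreasing_rearrangement (map s [0..<n]) = map (s \<circ> p) [0..<n] \<and>
     (\<forall>i j. i \<le> j \<longrightarrow> j < n \<longrightarrow> s (p j) \<le> s (p i))"
proof -
  define ys where "ys = decreasing_rearrangement (map s [0..<n])"
  have "mset ys = mset (map s [0..<n])" by (simp add: ys_def decreasing_rearrangement_def)
  then obtain p where p: "p permutes {..<n}" "permute_list p (map s [0..<n]) = ys"
    by (metis mset_eq_permutation length_map length_upt minus_nat.diff_0)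
  have lt: "p j < n" if "j < n" for j using permutes_in_image[OF p(1), of j] that by simp
  have ys: "ys = map (s \<circ> p) [0..<n]"
    using lt p(2) by (auto simp: permute_list_def)
  have "sorted (rev ys)" by (simp add: ys_def decreasing_rearrangement_def)
  then have "s (p j) \<le> s (p i)" if "i \<le> j" "j < n" for i j
    using sorted_rev_nth_mono[of ys i j] that by (simp add: ys)
  with permutes_imp_bij[OF p(1)] ys show ?thesis unfolding ys_def by blast
qed

text \<open>A prefix sum of \<open>xs\<close> is a sum over the sorted list with weights 0 and 1 and
  total weight \<open>k\<close>, so \<open>weighted_sum_le_top_sum\<close> applies.\<close>

lemma sum_list_take_le_decreasing_rearrangement:
  assumes "k \<le> length xs"
  shows "sum_list (take k xs) \<le> sum_list (take k (decreasing_rearrangement xs))"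
proof (cases "k = 0")
  case False
  define n where "n = length xs"
  have k: "1 \<le> k" "k \<le> n" using False assms by (auto simp: n_def)
  have xs: "xs = map ((!) xs) [0..<n]" by (simp add: n_def map_nth)
  obtain p where p: "bij_betw p {..<n} {..<n}"
    and "decreasing_rearrangement (map ((!) xs) [0..<n]) = map ((!) xs \<circ> p) [0..<n]"
    and sorted: "\<forall>i j. i \<le> j \<longrightarrow> j < n \<longrightarrow> xs ! p j \<le> xs ! p i"
    using decreasing_rearrangement_permutation[of n "(!) xs"] by (elim exE conjE)
  then have rearr: "decreasing_rearrangement xs = map ((!) xs \<circ> p) [0..<n]" using xs by simp
  \<comment> \<open>\<open>w\<close> marks the positions of the sorted list whose entry stems from
    the first \<open>k\<close> entries of \<open>xs\<close>.\<close>
  define w where "w j = (if p j < k then 1 else 0 :: real)" for j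
  have sub: "{..<n} \<inter> {i. i < k} = {..<k}" using k by auto
  have "sum w {..<n} = (\<Sum>i<n. if i < k then 1 else 0)"
    unfolding w_def by (rule sum.reindex_bij_betw[OF p])
  also have "\<dots> = real k"
    using sub sum.inter_restrict[of "{..<n}" "\<lambda>_. 1::real" "{j. j < k}"] by simp
  finally have total: "sum w {..<n} = real k" .
  have "sum_list (take k xs) = (\<Sum>i<k. xs ! i)"
    using k by (simp add: sum_list_sum_nth n_def lessThan_atLeast0)
  also have "\<dots> = (\<Sum>i<n. if i < k then xs ! i else 0)"
    using sub sum.inter_restrict[of "{..<n}" "(!) xs" "{j. j < k}"] by simp
  also have "\<dots> = (\<Sum>j<n. if p j < k then xs ! p j else 0)"
    by (rule sum.reindex_bij_betw[OF p, symmetric])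
  also have "\<dots> = (\<Sum>j<n. xs ! p j * w j)"
    by (intro sum.cong) (auto simp: w_def)
  also have "\<dots> \<le> (\<Sum>j<k. xs ! p j)"
    using sorted by (intro weighted_sum_le_top_sum[OF k]) (simp_all add: total, simp_all add: w_def)
  also have "\<dots> = sum_list (take k (decreasing_rearrangement xs))"
    using k by (simp add: rearr sum_list_sum_nth lessThan_atLeast0)
  finally show ?thesis .
qed simp

text \<open>Testing against the basis \<open>v\<close> shows that \<open>mat_adjoint M * M\<close>
  has eigenvector \<open>v j\<close> with eigenvalue the square of \<open>s j\<close>. The roots of
  its characteristic polynomial are therefore these squares, and \<open>s j \<ge> 0\<close> makes
  the square root return \<open>s j\<close>.\<close>

lemma singular_values_eq:
  assumes M: "M \<in> carrier_mat n n" and sys: "singular_system n M v u s"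
    and anti: "\<And>i j. i \<le> j \<Longrightarrow> j < n \<Longrightarrow> s j \<le> s i"
  shows "singular_values M = map s [0..<n]"
proof -
  have v: "orthonormal_on n {..<n} v" and u: "orthonormal_on n {..<n} u"
    and s: "\<And>j. j < n \<Longrightarrow> 0 \<le> s j" and Mv: "\<And>j. j < n \<Longrightarrow> M *\<^sub>v v j = of_real (s j) \<cdot>\<^sub>v u j"
    using sys by (auto simp: singular_system_def)
  have vc: "v j \<in> carrier_vec n" and uc: "u j \<in> carrier_vec n" if "j < n" for j
    using that v u by (auto simp: orthonormal_on_def)
  define H where "H = mat_adjoint M * M"
  have H: "H \<in> carrier_mat n n" using M mat_adjoint_carrier[OF M] by (simp add: H_def)
  have "H *\<^sub>v v j = of_real ((s j)\<^sup>2) \<cdot>\<^sub>v v j" if j: "j < n" for j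
  proof (rule orthonormal_basis_ext[OF v])
    fix i assume i: "i < n"
    have "(H *\<^sub>v v j) \<bullet>c v i = (M *\<^sub>v v j) \<bullet>c (M *\<^sub>v v i)"
      using M vc[OF i] vc[OF j] mat_adjoint_carrier[OF M]
      by (simp add: H_def cscalar_prod_mat_adjoint[of M n n])
    also have "\<dots> = of_real (s j) * (of_real (s i) * (u j \<bullet>c u i))"
      unfolding Mv[OF i] Mv[OF j] using uc[OF i] uc[OF j]
      by (subst cscalar_prod_smult_left[of _ n], simp, simp, subst cscalar_prod_smult_right[of _ n]) simp_all
    also have "\<dots> = of_real ((s j)\<^sup>2) * (v j \<bullet>c v i)"
      using orthonormal_onD(2)[OF u, of j i] orthonormal_onD(2)[OF v, of j i] i j
      by (simp add: power2_eq_square)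
    also have "\<dots> = (of_real ((s j)\<^sup>2) \<cdot>\<^sub>v v j) \<bullet>c v i"
      using vc[OF i] vc[OF j] by (simp only: cscalar_prod_smult_left)
    finally show "(H *\<^sub>v v j) \<bullet>c v i = (of_real ((s j)\<^sup>2) \<cdot>\<^sub>v v j) \<bullet>c v i" .
  qed (use H vc[OF j] in auto)
  from char_poly_orthonormal_eigenbasis[OF H v this]
  have "proots (char_poly H) = mset (map (\<lambda>j. of_real ((s j)\<^sup>2)) [0..<n])"
    by (simp only: proots_prod_linear_factors)
  then have "image_mset (\<lambda>z. sqrt (Re z)) (proots (char_poly H))
      = mset (map (\<lambda>j. sqrt (Re (of_real ((s j)\<^sup>2)))) [0..<n])"
    by (simp only: mset_map multiset.map_comp comp_def)
  also have "map (\<lambda>j. sqrt (Re (of_real ((s j)\<^sup>2)))) [0..<n] = map s [0..<n]"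
    using s by (simp only: Re_complex_of_real) simp
  finally have "singular_values M = rev (sort (map s [0..<n]))"
    unfolding singular_values_def H_def[symmetric] by (simp only: sorted_list_of_multiset_mset)
  then show ?thesis
    using decreasing_rearrangement_fixed[OF anti] by (simp only: decreasing_rearrangement_def)
qed

section \<open>Singular vectors of the block matrix with zero diagonal blocks\<close>

text \<open>The same \<open>v\<close>, \<open>u\<close>, \<open>s\<close> serve for all diagonal
  blocks in the last conclusion, so the value of the form on these pairs is shared by both matrices
  to be compared.\<close>

lemma antidiagonal_singular_system_exists:
  assumes A1: "A1 \<in> carrier_mat n n" and A2: "A2 \<in> carrier_mat n n"
  obtains v u s where
    "singular_system (n + n) (four_block_mat (0\<^sub>m n n) A2 A1 (0\<^sub>m n n)) v u s"
    "\<And>j. j < n + n \<Longrightarrow> v j \<bullet>c u j = 0"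
    "\<And>j A3 A4. j < n + n \<Longrightarrow> A3 \<in> carrier_mat n n \<Longrightarrow> A4 \<in> carrier_mat n n \<Longrightarrow>
       (four_block_mat A3 A2 A1 A4 *\<^sub>v v j) \<bullet>c u j = of_real (s j)"
proof -
  obtain v1 u1 s1 where sys1: "singular_system n A1 v1 u1 s1"
    using singular_system_exists[OF A1] by blast
  obtain v2 u2 s2 where sys2: "singular_system n A2 v2 u2 s2"
    using singular_system_exists[OF A2] by blast
  have c: "v1 j \<in> carrier_vec n" "u1 j \<in> carrier_vec n" "v2 j \<in> carrier_vec n" "u2 j \<in> carrier_vec n"
    if "j < n" for j
    using that sys1 sys2 by (simp_all add: singular_system_def orthonormal_on_def)
  have g: "v1 i \<bullet>c v1 j = (if i = j then 1 else 0)" "u1 i \<bullet>c u1 j = (if i = j then 1 else 0)"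
    "v2 i \<bullet>c v2 j = (if i = j then 1 else 0)" "u2 i \<bullet>c u2 j = (if i = j then 1 else 0)"
    if "i < n" "j < n" for i j
    using that sys1 sys2 by (simp_all add: singular_system_def orthonormal_on_def)
  have a: "A1 *\<^sub>v v1 j = of_real (s1 j) \<cdot>\<^sub>v u1 j" "A2 *\<^sub>v v2 j = of_real (s2 j) \<cdot>\<^sub>v u2 j"
    "0 \<le> s1 j" "0 \<le> s2 j"
    if "j < n" for j
    using that sys1 sys2 by (simp_all add: singular_system_def)
  \<comment> \<open>Indices below \<open>n\<close> carry the system of \<open>A1\<close>, with
    \<open>v\<close> in the upper and \<open>u\<close> in the lower block; the others carry that of
    \<open>A2\<close>, with the blocks exchanged.\<close>
  define v where "v j = (if j < n then v1 j @\<^sub>v 0\<^sub>v n else 0\<^sub>v n @\<^sub>v v2 (j - n))" for j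
  define u where "u j = (if j < n then 0\<^sub>v n @\<^sub>v u1 j else u2 (j - n) @\<^sub>v 0\<^sub>v n)" for j
  define s where "s j = (if j < n then s1 j else s2 (j - n))" for j
  have append: "(a @\<^sub>v b) \<bullet>c (c @\<^sub>v d) = a \<bullet>c c + b \<bullet>c d"
    if "a \<in> carrier_vec n" "b \<in> carrier_vec n" "c \<in> carrier_vec n" "d \<in> carrier_vec n"
    for a b c d :: "complex vec"
  proof -
    have "conjugate (c @\<^sub>v d) = conjugate c @\<^sub>v conjugate d"
      using that by (intro eq_vecI) auto
    then show ?thesis using that by (simp add: scalar_prod_append[of _ n _ n])
  qed
  have ip0: "a \<bullet>c 0\<^sub>v n = 0" "0\<^sub>v n \<bullet>c a = 0" if "a \<in> carrier_vec n" for a :: "complex vec"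
    using that by simp_all
  have carrier: "v j \<in> carrier_vec (n + n)" "u j \<in> carrier_vec (n + n)" if "j < n + n" for j
    using that by (cases "j < n"; simp add: v_def u_def c)+
  have "v i \<bullet>c v j = (if i = j then 1 else 0)" "u i \<bullet>c u j = (if i = j then 1 else 0)"
    if "i < n + n" "j < n + n" for i j
    using that by (cases "i < n"; cases "j < n"; force simp: v_def u_def append ip0 c g)+
  with carrier have "orthonormal_on (n + n) {..<n + n} v" "orthonormal_on (n + n) {..<n + n} u"
    by (simp_all add: orthonormal_on_def)
  \<comment> \<open>The diagonal blocks \<open>B\<close> and \<open>C\<close> contribute only to the
    half in which the partner \<open>u j\<close> is zero, so they drop out of the inner product with
    \<open>u j\<close>.\<close>
  moreover have block: "four_block_mat B A2 A1 C *\<^sub>v v j =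
      (if j < n then (B *\<^sub>v v1 j) @\<^sub>v (of_real (s j) \<cdot>\<^sub>v u1 j)
       else (of_real (s j) \<cdot>\<^sub>v u2 (j - n)) @\<^sub>v (C *\<^sub>v v2 (j - n)))"
    if "j < n + n" and BC: "B \<in> carrier_mat n n" "C \<in> carrier_mat n n" for B C j
  proof -
    have mult: "four_block_mat B A2 A1 C *\<^sub>v (x @\<^sub>v y) = (B *\<^sub>v x + A2 *\<^sub>v y) @\<^sub>v (A1 *\<^sub>v x + C *\<^sub>v y)"
      if "x \<in> carrier_vec n" "y \<in> carrier_vec n" for x y
      using four_block_mat_mult_vec[OF BC(1) A2 A1 BC(2) that] .
    have zero: "K *\<^sub>v 0\<^sub>v n = 0\<^sub>v n" if "K \<in> carrier_mat n n" for K :: "complex mat"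
      using that by (intro eq_vecI) (auto simp: scalar_prod_def)
    show ?thesis
    proof (cases "j < n")
      case True
      then show ?thesis
        using mult_mat_vec_carrier[OF BC(1) c(1)] smult_carrier_vec[THEN iffD2, OF c(2)]
        by (simp add: v_def s_def mult zero A2 BC a c)
    next
      case False
      then have "j - n < n" using that by simp
      then show ?thesis
        using False mult_mat_vec_carrier[OF BC(2) c(3)] smult_carrier_vec[THEN iffD2, OF c(4)]
        by (simp add: v_def s_def mult zero A1 BC a c)
    qed
  qed
  moreover have "four_block_mat (0\<^sub>m n n) A2 A1 (0\<^sub>m n n) *\<^sub>v v j = of_real (s j) \<cdot>\<^sub>v u j"
    if j: "j < n + n" for j
  proof -
    have zero: "0\<^sub>m n n *\<^sub>v x = 0\<^sub>v n" if "x \<in> carrier_vec n" for x :: "complex vec"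
      using that by (intro eq_vecI) auto
    have smult0: "r \<cdot>\<^sub>v 0\<^sub>v n = 0\<^sub>v n" for r :: complex
      by (intro eq_vecI) auto
    have app: "r \<cdot>\<^sub>v (x @\<^sub>v y) = (r \<cdot>\<^sub>v x) @\<^sub>v (r \<cdot>\<^sub>v y)" for r :: complex and x y
      by (intro eq_vecI) auto
    have "j - n < n" if "\<not> j < n" using that j by simp
    then show ?thesis
      using j by (cases "j < n") (simp_all add: block zero app smult0 u_def c)
  qed
  moreover have "0 \<le> s j" if "j < n + n" for j
    using that by (cases "j < n") (simp_all add: s_def a)
  ultimately have "singular_system (n + n) (four_block_mat (0\<^sub>m n n) A2 A1 (0\<^sub>m n n)) v u s"
    by (simp add: singular_system_def)
  moreover have "v j \<bullet>c u j = 0" if "j < n + n" for j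
    using that by (cases "j < n") (simp_all add: v_def u_def append ip0 c)
  moreover have "(four_block_mat B A2 A1 C *\<^sub>v v j) \<bullet>c u j = of_real (s j)"
    if "j < n + n" and BC: "B \<in> carrier_mat n n" "C \<in> carrier_mat n n" for B C j
  proof (cases "j < n")
    case True
    then show ?thesis
      using mult_mat_vec_carrier[OF BC(1) c(1)[OF True]] c(2)[OF True] g(2)[OF True True]
      by (simp add: block[OF that] u_def append ip0 cscalar_prod_smult_left[of _ n])
  next
    case False
    then have j: "j - n < n" using that by simp
    then show ?thesis
      using False mult_mat_vec_carrier[OF BC(2) c(3)[OF j]] c(4)[OF j] g(4)[OF j j]
      by (simp add: block[OF that] u_def append ip0 cscalar_prod_smult_left[of _ n])
  qed
  ultimately show thesis using that[of v u s] by simp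
qed

subsection \<open>Discrepancy values\<close>

lemma orthonormal_family_iff_orthonormal_on:
  "orthonormal_family n k x \<longleftrightarrow> orthonormal_on n {1..k} x"
  by (simp only: orthonormal_family_def orthonormal_on_def)

text \<open>A supremum of reals dominates the elements of its set only if the set is bounded. Ky
  Fan's bound for a sorted singular system of \<open>M\<close> provides this.\<close>

lemma bdd_above_discrepancy_set:
  assumes M: "M \<in> carrier_mat n n" and k: "1 \<le> k" "k \<le> n"
  shows "bdd_above {cmod (\<Sum>i=1..k. (M *\<^sub>v x i) \<bullet>c y i) | x y.
     orthonormal_family n k x \<and> orthonormal_family n k y \<and> (\<Sum>i=1..k. x i \<bullet>c y i) = 0}"
proof -
  obtain v u s where sys: "singular_system n M v u s" by (rule singular_system_exists[OF M])
  obtain p where p: "bij_betw p {..<n} {..<n}" and "\<forall>i j. i \<le> j \<longrightarrow> j < n \<longrightarrow> s (p j) \<le> s (p i)"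
    using decreasing_rearrangement_permutation[of n s] by (elim exE conjE)
  then have anti: "(s \<circ> p) j \<le> (s \<circ> p) i" if "i \<le> j" "j < n" for i j
    using that by simp
  have "cmod (\<Sum>i=1..k. (M *\<^sub>v x i) \<bullet>c y i) \<le> (\<Sum>j<k. (s \<circ> p) j)"
    if "orthonormal_family n k x" "orthonormal_family n k y" for x y
  proof (rule ky_fan_upper_bound[OF M singular_system_permute[OF sys p] anti k])
    show "orthonormal_on n {1..k} x" "orthonormal_on n {1..k} y"
      using that by (simp_all only: orthonormal_family_iff_orthonormal_on)
  qed simp_all
  then show ?thesis
    by (intro bdd_aboveI[of _ "\<Sum>j<k. (s \<circ> p) j"]) (elim CollectE exE conjE, simp only:)
qed

text \<open>The sum telescopes down to the seminorm of index 0, which is 0. The list is the one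
  before rearrangement.\<close>

lemma sum_discrepancy_values:
  assumes "k \<le> dim_row M"
  shows "sum_list (take k (map (\<lambda>k. discrepancy_value k M) [1..<dim_row M + 1])) = discrepancy_seminorm k M"
  using assms
proof (induction k)
  case 0
  then show ?case by (simp add: discrepancy_seminorm_def)
next
  case (Suc k)
  then show ?case
    by (simp add: take_Suc_conv_app_nth discrepancy_value_def del: upt_Suc)
qed

section \<open>Comparison of the two block matrices\<close>

theorem mainTheorem5:
  fixes n :: nat and A1 A2 A3 A4 :: "complex mat"
  assumes "A1 \<in> carrier_mat n n" and "A2 \<in> carrier_mat n n"
    and "A3 \<in> carrier_mat n n" and "A4 \<in> carrier_mat n n"
  shows "singular_values (four_block_mat (0\<^sub>m n n) A2 A1 (0\<^sub>m n n))
           = discrepancy_values (four_block_mat (0\<^sub>m n n) A2 A1 (0\<^sub>m n n)) \<and>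
         discrepancy_values (four_block_mat (0\<^sub>m n n) A2 A1 (0\<^sub>m n n))
           \<prec>\<^sub>w discrepancy_values (four_block_mat A3 A2 A1 A4)"
proof -
  define N where "N = n + n"
  define M0 where "M0 = four_block_mat (0\<^sub>m n n) A2 A1 (0\<^sub>m n n)"
  define M where "M = four_block_mat A3 A2 A1 A4"
  have M0: "M0 \<in> carrier_mat N N" and M: "M \<in> carrier_mat N N"
    using assms by (auto simp: M0_def M_def N_def)
  obtain v' u' s' where sys': "singular_system N M0 v' u' s'"
    and orth': "\<And>j. j < N \<Longrightarrow> v' j \<bullet>c u' j = 0"
    and diag': "\<And>j A3 A4. j < N \<Longrightarrow> A3 \<in> carrier_mat n n \<Longrightarrow> A4 \<in> carrier_mat n n \<Longrightarrow>
       (four_block_mat A3 A2 A1 A4 *\<^sub>v v' j) \<bullet>c u' j = of_real (s' j)"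
    using antidiagonal_singular_system_exists[OF assms(1,2)] unfolding M0_def N_def by blast
  \<comment> \<open>The values are sorted and both families are reindexed alike, so each pair keeps
    its orthogonality and its value.\<close>
  obtain p where p: "bij_betw p {..<N} {..<N}" and sorted: "\<forall>i j. i \<le> j \<longrightarrow> j < N \<longrightarrow> s' (p j) \<le> s' (p i)"
    using decreasing_rearrangement_permutation[of N s'] by (elim exE conjE)
  define v u s where "v = v' \<circ> p" and "u = u' \<circ> p" and "s = s' \<circ> p"
  have pN: "p j < N" if "j < N" for j using p that by (auto simp: bij_betw_def)
  have sys: "singular_system N M0 v u s"
    unfolding v_def u_def s_def by (rule singular_system_permute[OF sys' p])
  have anti: "\<And>i j. i \<le> j \<Longrightarrow> j < N \<Longrightarrow> s j \<le> s i" using sorted by (simp add: s_def)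
  have orth: "v j \<bullet>c u j = 0" if "j < N" for j using orth' pN[OF that] by (simp add: v_def u_def)
  \<comment> \<open>\<open>diag'\<close> is instantiated with zero diagonal blocks for
    \<open>M0\<close> and with \<open>A3\<close>, \<open>A4\<close> for \<open>M\<close>.\<close>
  have diag: "(B *\<^sub>v v j) \<bullet>c u j = of_real (s j)" if "j < N" "B = M0 \<or> B = M" for B j
    using diag'[OF pN[OF that(1)]] that(2) assms(3,4) by (auto simp: M0_def M_def v_def u_def s_def)
  have s_nonneg: "0 \<le> s j" if "j < N" for j using sys that by (simp add: singular_system_def)

  \<comment> \<open>Singular systems are indexed from 0 and the families of the seminorm from 1; on
    \<open>{1..k}\<close> the shift is injective.\<close>
  have family: "orthonormal_family N k (v \<circ> (\<lambda>i. i - 1))" "orthonormal_family N k (u \<circ> (\<lambda>i. i - 1))"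
    if "k \<le> N" for k
  proof -
    have "inj_on (\<lambda>i. i - 1) {1..k}" by (intro inj_onI) auto
    moreover have "(\<lambda>i. i - 1) ` {1..k} \<subseteq> {..<N}" using that by auto
    ultimately show "orthonormal_family N k (v \<circ> (\<lambda>i. i - 1))" "orthonormal_family N k (u \<circ> (\<lambda>i. i - 1))"
      unfolding orthonormal_family_iff_orthonormal_on
      using sys by (auto simp only: singular_system_def intro: orthonormal_on_reindex)
  qed
  \<comment> \<open>Each pair is orthogonal by itself, so the first \<open>k\<close> pairs are
    admissible for every \<open>k\<close>, and the form takes the value of the top \<open>k\<close>
    sum for both matrices.\<close>
  have lower: "(\<Sum>j<k. s j) \<le> discrepancy_seminorm k B"
    if k: "1 \<le> k" "k \<le> N" and B: "B = M0 \<or> B = M" for k B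
  proof -
    define x y where "x i = v (i - 1)" and "y i = u (i - 1)" for i :: nat
    have xy: "orthonormal_family N k x" "orthonormal_family N k y"
      using family[OF k(2)] by (simp_all add: x_def[abs_def] y_def[abs_def] comp_def)
    have zero: "(\<Sum>i=1..k. x i \<bullet>c y i) = 0"
      using orth k by (intro sum.neutral) (auto simp: x_def y_def)
    have "(\<Sum>i=1..k. (B *\<^sub>v x i) \<bullet>c y i) = (\<Sum>i=1..k. of_real (s (i - 1)))"
      using diag[OF _ B] k by (intro sum.cong) (auto simp: x_def y_def)
    also have "\<dots> = of_real (\<Sum>j<k. s j)"
      by (simp add: sum.atLeast1_atMost_eq)
    finally have "cmod (\<Sum>i=1..k. (B *\<^sub>v x i) \<bullet>c y i) = \<bar>\<Sum>j<k. s j\<bar>"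
      by (simp only: norm_of_real)
    also have "\<dots> = (\<Sum>j<k. s j)" using s_nonneg k by (intro abs_of_nonneg sum_nonneg) auto
    finally have attained: "(\<Sum>j<k. s j) = cmod (\<Sum>i=1..k. (B *\<^sub>v x i) \<bullet>c y i)" by simp
    have carrier: "B \<in> carrier_mat N N" using B M0 M by auto
    have "(\<Sum>j<k. s j) \<le> Sup {cmod (\<Sum>i=1..k. (B *\<^sub>v x i) \<bullet>c y i) | x y.
       orthonormal_family N k x \<and> orthonormal_family N k y \<and> (\<Sum>i=1..k. x i \<bullet>c y i) = 0}"
      using xy zero attained by (intro cSup_upper bdd_above_discrepancy_set[OF carrier k]) blast
    then show ?thesis using carrier k by (simp add: discrepancy_seminorm_def)
  qed
  have upper: "discrepancy_seminorm k M0 \<le> (\<Sum>j<k. s j)" if k: "1 \<le> k" "k \<le> N" for k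
  proof -
    let ?S = "{cmod (\<Sum>i=1..k. (M0 *\<^sub>v x i) \<bullet>c y i) | x y.
       orthonormal_family N k x \<and> orthonormal_family N k y \<and> (\<Sum>i=1..k. x i \<bullet>c y i) = 0}"
    have "(\<Sum>i=1..k. (v \<circ> (\<lambda>i. i - 1)) i \<bullet>c (u \<circ> (\<lambda>i. i - 1)) i) = 0"
      using orth k by (intro sum.neutral) auto
    \<comment> \<open>Nonemptiness, which \<open>cSup_least\<close> requires, is again witnessed by
      the singular vectors.\<close>
    then have "?S \<noteq> {}" using family[OF k(2)] by blast
    moreover have "cmod (\<Sum>i=1..k. (M0 *\<^sub>v x i) \<bullet>c y i) \<le> (\<Sum>j<k. s j)"
      if "orthonormal_family N k x" "orthonormal_family N k y" for x y
      using that unfolding orthonormal_family_iff_orthonormal_on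
      by (intro ky_fan_upper_bound[OF M0 sys anti k]) simp_all
    then have "t \<le> (\<Sum>j<k. s j)" if "t \<in> ?S" for t using that by blast
    ultimately have "Sup ?S \<le> (\<Sum>j<k. s j)" by (intro cSup_least) blast+
    then show ?thesis using M0 k by (simp add: discrepancy_seminorm_def)
  qed
  have seminorm: "discrepancy_seminorm k M0 = (\<Sum>j<k. s j)" if "k \<le> N" for k
    using lower[of k M0] upper[of k] that by (cases "k = 0") (auto simp: discrepancy_seminorm_def)
  \<comment> \<open>Differences of consecutive prefix sums give back the summands; the discrepancy
    value of index \<open>Suc i\<close> is \<open>s i\<close>.\<close>
  have "map (\<lambda>k. discrepancy_value k M0) [1..<N + 1] = map s [0..<N]"
  proof (rule nth_equalityI)
    fix i assume "i < length (map (\<lambda>k. discrepancy_value k M0) [1..<N + 1])"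
    then show "map (\<lambda>k. discrepancy_value k M0) [1..<N + 1] ! i = map s [0..<N] ! i"
      using seminorm[of "Suc i"] seminorm[of i] by (simp add: discrepancy_value_def del: upt_Suc)
  qed simp
  then have disc: "discrepancy_values M0 = map s [0..<N]"
    using M0 decreasing_rearrangement_fixed[OF anti]
    by (simp add: discrepancy_values_def del: upt_Suc)
  have "sum_list (take k (decreasing_rearrangement (discrepancy_values M0)))
      \<le> sum_list (take k (decreasing_rearrangement (discrepancy_values M)))"
    if k: "1 \<le> k" "k \<le> N" for k
  proof -
    let ?d = "map (\<lambda>k. discrepancy_value k M) [1..<dim_row M + 1]"
    have "sum_list (take k (decreasing_rearrangement (discrepancy_values M0))) = (\<Sum>j<k. s j)"
      using k decreasing_rearrangement_fixed[OF anti]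
      by (simp add: disc sum_list_sum_nth lessThan_atLeast0)
    \<comment> \<open>For \<open>M\<close> the singular vectors of \<open>M0\<close> are merely one
      admissible choice, which yields the inequality.\<close>
    also have "\<dots> \<le> discrepancy_seminorm k M" using lower k by blast
    also have "\<dots> = sum_list (take k ?d)"
      using M k sum_discrepancy_values[of k M] by simp
    \<comment> \<open>The telescoped sum runs in the original order of the discrepancy values;
      sorting can only increase it.\<close>
    also have "\<dots> \<le> sum_list (take k (decreasing_rearrangement ?d))"
      using M k by (intro sum_list_take_le_decreasing_rearrangement) simp
    also have "\<dots> = sum_list (take k (decreasing_rearrangement (discrepancy_values M)))"
      by (simp only: discrepancy_values_def decreasing_rearrangement_idem)
    finally show ?thesis .
  qed
  then have "discrepancy_values M0 \<prec>\<^sub>w discrepancy_values M"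
    using M0 M by (simp add: weakly_majorized_def discrepancy_values_def decreasing_rearrangement_def del: upt_Suc)
  moreover have "singular_values M0 = discrepancy_values M0"
    using singular_values_eq[OF M0 sys anti] disc by (simp only:)
  ultimately show ?thesis by (simp add: M0_def M_def)
qed

end
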